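(* Let $G$ be a connected $m$-uniform hypergraph on $n$ vertices, where $m$ is even, and suppose the incidence matrix $B_G$ has rank $\bar r$ over $\mathbb{Z}_2$. Then $1\le\bar r\le n-1$, and $\mathrm{H}\mathbb{P}V_0^{\mathcal L}(G)$ is a $\mathbb{Z}_2$-linear space of dimension $n-1-\bar r$. Consequently, $G$ has exactly $2^{n-1-\bar r}$ first Laplacian H-eigenvectors (counted up to scalar).
   Context: An $m$-uniform hypergraph $G$ has edges that are $m$-element subsets of its vertex set $[n]$. Its adjacency tensor $\mathcal{A}(G)$ has entry $\frac{1}{(m-1)!}$ at $(i_1,\dots,i_m)$ if $\{i_1,\dots,i_m\}$ is an edge and $0$ otherwise; $\mathcal{D}(G)$ is the diagonal tensor of vertex degrees; $\mathcal{L}(G)=\mathcal{D}(G)-\mathcal{A}(G)$. A first Laplacian eigenvector is a nonzero $x\in\mathbb{C}^n$ with $\sum_{i_2,\dots,i_m}\mathcal{L}(G)_{ii_2\cdots i_m}x_{i_2}\cdots x_{i_m}=0$ for all $i$, counted as a point of $\mathbb{P}^{n-1}$; it is an H-eigenvector if it is a scalar multiple of a real vector. $\mathrm{H}\mathbb{P}V_0^{\mathcal L}(G)$ is the set of first Laplacian H-eigenvectors in $\mathbb{P}^{n-1}$; each has a unique representative in $\{1,-1\}^n$ with first coordinate $1$, and $\mathrm{H}\mathbb{P}V_0^{\mathcal L}(G)$ is a $\mathbb{Z}_2$-linear space under the entrywise (Hadamard) product of these representatives. $B_G$ is the $|E(G)|\times n$ incidence matrix ($(e,v)$ entry $1$ iff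 $v\in e$, else $0$). *)

theory Defs
  imports
    "Jordan_Normal_Form.DL_Rank"
    "HOL-Library.Z2"
    Complex_Main
begin

text \<open>
  The vertex set $[n]$ is rendered as \<open>{..<n}\<close>, matching the \<open>0\<close>-based indices of
  vectors and matrices; the ``first'' coordinate is therefore coordinate \<open>0\<close>.
  A hypergraph on it is given by its set of edges.
\<close>

definition uniform_hypergraph :: "nat \<Rightarrow> nat \<Rightarrow> nat set set \<Rightarrow> bool" where
  "uniform_hypergraph m n E \<longleftrightarrow> (\<forall>e\<in>E. e \<subseteq> {..<n} \<and> card e = m)"

definition adjacent_rel :: "nat set set \<Rightarrow> (nat \<times> nat) set" where
  "adjacent_rel E = {(u, v). \<exists>e\<in>E. u \<in> e \<and> v \<in> e}"

definition connected_hypergraph :: "nat \<Rightarrow> nat set set \<Rightarrow> bool" where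
  "connected_hypergraph n E \<longleftrightarrow> (\<forall>u<n. \<forall>v<n. (u, v) \<in> (adjacent_rel E)\<^sup>*)"

definition degree :: "nat set set \<Rightarrow> nat \<Rightarrow> nat" where
  "degree E v = card {e \<in> E. v \<in> e}"


text \<open>
  A tensor of order \<open>m\<close> and dimension \<open>n\<close> is a function on index lists
  $[i_1,\dots,i_m]$ of length \<open>m\<close> with entries below \<open>n\<close>; its values on other lists
  are irrelevant.
\<close>

type_synonym tensor = "nat list \<Rightarrow> complex"

definition adjacency_tensor :: "nat \<Rightarrow> nat set set \<Rightarrow> tensor" where
  "adjacency_tensor m E = (\<lambda>is. if set is \<in> E then 1 / fact (m - 1) else 0)"

definition degree_tensor :: "nat \<Rightarrow> nat set set \<Rightarrow> tensor" where
  "degree_tensor m E = (\<lambda>is. if is = replicate m (hd is) then of_nat (degree E (hd is)) else 0)"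

definition laplacian_tensor :: "nat \<Rightarrow> nat set set \<Rightarrow> tensor" where
  "laplacian_tensor m E = (\<lambda>is. degree_tensor m E is - adjacency_tensor m E is)"

text \<open>The \<open>i\<close>-th entry of $\mathcal{T} x^{m-1}$.\<close>

definition tensor_apply :: "nat \<Rightarrow> nat \<Rightarrow> tensor \<Rightarrow> complex vec \<Rightarrow> nat \<Rightarrow> complex" where
  "tensor_apply m n T x i =
     (\<Sum>is\<in>{is. length is = m - 1 \<and> set is \<subseteq> {..<n}}. T (i # is) * (\<Prod>j\<leftarrow>is. x $ j))"

definition first_laplacian_eigenvector :: "nat \<Rightarrow> nat \<Rightarrow> nat set set \<Rightarrow> complex vec \<Rightarrow> bool" where
  "first_laplacian_eigenvector m n E x \<longleftrightarrow>
     x \<in> carrier_vec n \<and> x \<noteq> 0\<^sub>v n \<and>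
     (\<forall>i<n. tensor_apply m n (laplacian_tensor m E) x i = 0)"

definition multiple_of_real :: "nat \<Rightarrow> complex vec \<Rightarrow> bool" where
  "multiple_of_real n x \<longleftrightarrow>
     (\<exists>c. \<exists>y\<in>carrier_vec n. (\<forall>i<n. y $ i \<in> \<real>) \<and> x = c \<cdot>\<^sub>v y)"


text \<open>
  A point of $\mathbb{P}^{n-1}$ is the set of all nonzero multiples of a nonzero vector.
\<close>

definition proj_point :: "complex vec \<Rightarrow> complex vec set" where
  "proj_point x = {c \<cdot>\<^sub>v x | c. c \<noteq> 0}"

definition HPV0 :: "nat \<Rightarrow> nat \<Rightarrow> nat set set \<Rightarrow> complex vec set set" where
  "HPV0 m n E = {proj_point x | x. first_laplacian_eigenvector m n E x \<and> multiple_of_real n x}"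

definition sign_reps :: "nat \<Rightarrow> complex vec set \<Rightarrow> complex vec set" where
  "sign_reps n P = {v \<in> P. v \<in> carrier_vec n \<and> (\<forall>i<n. v $ i \<in> {1, -1}) \<and> v $ 0 = 1}"

definition hadamard :: "nat \<Rightarrow> complex vec \<Rightarrow> complex vec \<Rightarrow> complex vec" where
  "hadamard n u v = vec n (\<lambda>i. u $ i * v $ i)"

text \<open>
  A point has at most one representative in \<open>sign_reps\<close>, because a multiple of a vector
  with first coordinate \<open>1\<close> that again has first coordinate \<open>1\<close> is the vector itself.
  So the union below is over at most one pair \<open>(u, v)\<close>. If \<open>P\<close> or \<open>Q\<close> had no such
  representative, the product would be the empty set, which is not a point; hence closure of
  \<open>HPV0\<close> under the product includes the existence of the representatives.
\<close>

definition hadamard_point :: "nat \<Rightarrow> complex vec set \<Rightarrow> complex vec set \<Rightarrow> complex vec set" where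
  "hadamard_point n P Q = (\<Union>u\<in>sign_reps n P. \<Union>v\<in>sign_reps n Q. proj_point (hadamard n u v))"

text \<open>
  The $\mathbb{Z}_2$-linear structure: addition is the Hadamard product, the zero vector is
  the point of the all-ones vector. As for \<open>module_vec\<close>, the ring fields
  \<open>mult\<close> and \<open>one\<close> of the record play no role.
\<close>

definition HPV0_space :: "nat \<Rightarrow> nat \<Rightarrow> nat set set \<Rightarrow> (bit, complex vec set) module" where
  "HPV0_space m n E =
     \<lparr> carrier = HPV0 m n E,
       mult = undefined,
       one = undefined,
       zero = proj_point (vec n (\<lambda>_. 1)),
       add = hadamard_point n,
       smult = (\<lambda>a P. if a = 0 then proj_point (vec n (\<lambda>_. 1)) else P) \<rparr>"


text \<open>The rows are ordered by a list \<open>es\<close> enumerating the edges.\<close>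

definition incidence_mat :: "nat \<Rightarrow> nat set list \<Rightarrow> 'a::zero_neq_one mat" where
  "incidence_mat n es = mat (length es) n (\<lambda>(k, v). if v \<in> es ! k then 1 else 0)"

end

theory Submission
  imports Defs "Jordan_Normal_Form.Matrix_Kernel" "HOL-Combinatorics.Multiset_Permutations"
begin

text \<open>
  Write the eigenvector equation as
  \<open>deg(i) x\<^sub>i\<^sup>m\<^sup>-\<^sup>1 = (\<Sum>e\<ni>i. \<Prod>j\<in>e - {i}. x\<^sub>j)\<close>. If \<open>x\<close> is real
  and is normalised to have maximal absolute value \<open>1\<close>, then at a coordinate of absolute
  value \<open>1\<close> every one of the \<open>deg(i)\<close> summands on the right must be extremal, so all
  neighbours of that coordinate have absolute value \<open>1\<close> as well; by connectedness \<open>x\<close> is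
  a sign vector whose product over each edge is \<open>1\<close>. Hence the first Laplacian
  H-eigenvectors correspond to the \<open>s\<close> in the kernel of the incidence matrix over
  \<open>\<int>\<^sub>2\<close> with first coordinate \<open>0\<close>. As \<open>m\<close> is even, the all-ones vector is in the kernel,
  so these \<open>s\<close> make up half of it, and all dimensions are read off from cardinalities.
\<close>

section \<open>Cardinalities of kernels over the two-element field\<close>

lemma (in vectorspace) fin_dim_if_finite_carrier:
  assumes "finite (carrier V)"
  shows "fin_dim"
  unfolding fin_dim_def using assms in_own_span[of "carrier V"] span_is_subset2[of "carrier V"]
  by blast

text \<open>A finite basis \<open>B\<close> gives each vector exactly one family of coordinates, so
  \<open>lincomb\<close> is a bijection from the extensional functions
  \<open>B \<rightarrow>\<^sub>E carrier K\<close> onto the space.\<close>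

lemma (in vectorspace) card_carrier_eq_power_dim:
  assumes "finite (carrier K)" and "fin_dim"
  shows "card (carrier V) = card (carrier K) ^ dim"
proof -
  obtain B where B: "finite B" "basis B"
    using finite_basis_exists[OF assms(2)] by blast
  have BV: "B \<subseteq> carrier V"
    using B(2) unfolding basis_def by blast
  have unique: "\<exists>!a. a \<in> B \<rightarrow>\<^sub>E carrier K \<and> lincomb a B = v" if "v \<in> carrier V" for v
    using basis_criterion[OF B(1) BV] B(2) that by blast
  have closed: "lincomb a B \<in> carrier V" if "a \<in> B \<rightarrow>\<^sub>E carrier K" for a
    using that BV by (intro lincomb_closed) auto
  have "bij_betw (\<lambda>a. lincomb a B) (B \<rightarrow>\<^sub>E carrier K) (carrier V)"
    unfolding bij_betw_def inj_on_def using unique closed by blast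
  then have "card (carrier V) = card (B \<rightarrow>\<^sub>E carrier K)"
    using bij_betw_same_card by fastforce
  then show ?thesis
    using B dim_basis by (simp add: card_PiE)
qed

text \<open>Rank-nullity for the linear map \<open>x\<close> to \<open>A *\<^sub>v x\<close>: its
  image is the span of the columns, whose dimension is \<open>rank A\<close> by definition, and its
  kernel is \<open>mat_kernel A\<close>.\<close>

lemma (in vec_space) rank_plus_dim_mat_kernel:
  assumes A: "A \<in> carrier_mat n nc"
  shows "rank A + vectorspace.dim class_ring
    (module_vec TYPE('a) nc\<lparr>carrier := mat_kernel A\<rparr>) = nc"
proof -
  interpret N: vec_space f_ty nc .
  have hom: "(\<lambda>x. A *\<^sub>v x) \<in> LinearCombinations.module_hom class_ring (module_vec TYPE('a) nc) (module_vec TYPE('a) n)"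
    using A by (auto simp: LinearCombinations.module_hom_def module_vec_simps mult_add_distrib_mat_vec[OF A]
        mult_mat_vec[OF A])
  interpret T: linear_map "class_ring :: 'a ring" "module_vec TYPE('a) nc" "module_vec TYPE('a) n"
    "\<lambda>x. A *\<^sub>v x"
    by unfold_locales (rule hom)
  have "T.im = span (set (cols A))"
    using col_space_eq[OF A] A unfolding T.im_def col_space_def
    by (auto simp: module_vec_simps)
  moreover have "T.ker = mat_kernel A"
    unfolding T.ker_def mat_kernel[OF A] by (auto simp: module_vec_simps)
  ultimately show ?thesis
    using T.rank_nullity[OF N.fin_dim] N.dim_is_n unfolding rank_def by simp
qed

lemma mat_kernel_add:
  assumes "A \<in> carrier_mat nr nc" "v \<in> mat_kernel A" "w \<in> mat_kernel A"
  shows "v + w \<in> mat_kernel A"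
  using assms by (auto simp: mat_kernel mult_add_distrib_mat_vec)

lemma card_UNIV_bit: "card (UNIV :: bit set) = 2" and finite_UNIV_bit: "finite (UNIV :: bit set)"
proof -
  have univ: "(UNIV :: bit set) = {0, 1}"
    using bit_not_zero_iff by blast
  show "card (UNIV :: bit set) = 2"
    by (simp add: univ)
  show "finite (UNIV :: bit set)"
    by (simp add: univ)
qed

lemma finite_carrier_vec_bit: "finite (carrier_vec n :: bit vec set)"
proof (rule finite_subset)
  show "carrier_vec n \<subseteq> vec_of_list ` {xs :: bit list. set xs \<subseteq> UNIV \<and> length xs = n}"
    by (auto simp: image_iff intro!: exI[of _ "list_of_vec _"] vec_list[symmetric])
  show "finite (vec_of_list ` {xs :: bit list. set xs \<subseteq> UNIV \<and> length xs = n})"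
    by (intro finite_imageI finite_lists_length_eq finite_UNIV_bit)
qed

lemma card_carrier_vec_bit: "card (carrier_vec n :: bit vec set) = 2 ^ n"
proof -
  interpret N: vec_space "TYPE(bit)" n .
  show ?thesis
    using N.card_carrier_eq_power_dim N.fin_dim N.dim_is_n card_UNIV_bit finite_UNIV_bit by simp
qed

text \<open>Over the two-element field, rank-nullity turns into a count. The product form avoids a
  truncated subtraction in the exponent, and the later dimension formula comes from comparing such
  powers of 2.\<close>

lemma
  fixes A :: "bit mat"
  assumes A: "A \<in> carrier_mat nr nc"
  shows finite_mat_kernel_bit: "finite (mat_kernel A)"
    and card_mat_kernel_bit: "card (mat_kernel A) * 2 ^ vec_space.rank nr A = 2 ^ nc"
proof -
  interpret R: vec_space "TYPE(bit)" nr .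
  interpret kernel nr nc A by unfold_locales (rule A)
  show fin: "finite (mat_kernel A)"
    using finite_carrier_vec_bit mat_kernel_carrier[OF A] finite_subset by blast
  have "card (mat_kernel A) = 2 ^ Ker.dim"
    using Ker.card_carrier_eq_power_dim Ker.fin_dim_if_finite_carrier fin
      card_UNIV_bit finite_UNIV_bit by simp
  then show "card (mat_kernel A) * 2 ^ R.rank A = 2 ^ nc"
    using R.rank_plus_dim_mat_kernel[OF A] by (metis add.commute power_add)
qed

section \<open>The eigenvector equation\<close>

text \<open>The \<open>m - 1\<close> entries have to cover the \<open>m - 1\<close> elements of
  \<open>e - {i}\<close>, which leaves no room for a repetition or for \<open>i\<close>
  itself.\<close>

lemma lists_completing_edge:
  assumes "finite e" and "card e = m" and "i \<in> e"
  shows "{is. length is = m - 1 \<and> insert i (set is) = e} = permutations_of_set (e - {i})"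
proof (intro equalityI subsetI)
  have card: "card (e - {i}) = m - 1" and fin: "finite (e - {i})"
    using assms by simp_all
  fix xs
  assume "xs \<in> {is. length is = m - 1 \<and> insert i (set is) = e}"
  then have len: "length xs = m - 1" and sub: "e - {i} \<subseteq> set xs" and ins: "insert i (set xs) = e"
    by auto
  have "card (set xs) \<le> card (e - {i})"
    using card_length[of xs] len card by simp
  then have "set xs = e - {i}"
    using card_seteq[of "set xs" "e - {i}"] sub by simp
  moreover from this have "distinct xs"
    using len card by (simp add: card_distinct)
  ultimately show "xs \<in> permutations_of_set (e - {i})"
    by (simp add: permutations_of_set_def)
next
  fix xs
  assume "xs \<in> permutations_of_set (e - {i})"
  then have xs: "set xs = e - {i}" "distinct xs"
    by (simp_all add: permutations_of_set_def)
  then have "length xs = m - 1"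
    using assms distinct_card[of xs] by simp
  then show "xs \<in> {is. length is = m - 1 \<and> insert i (set is) = e}"
    using xs assms(3) by (simp add: insert_absorb)
qed

text \<open>Each edge through \<open>i\<close> is completed by the \<open>(m - 1)!\<close> orderings
  of \<open>e - {i}\<close>. They all contribute the same product, so their number cancels the
  normalisation \<open>1 / fact (m - 1)\<close>.\<close>

lemma adjacency_tensor_apply:
  assumes unif: "uniform_hypergraph m n E" and fin: "finite E" and m: "0 < m" and i: "i < n"
  shows "tensor_apply m n (adjacency_tensor m E) x i = (\<Sum>e | e \<in> E \<and> i \<in> e. \<Prod>j\<in>e - {i}. x $ j)"
proof -
  let ?L = "{is. length is = m - 1 \<and> set is \<subseteq> {..<n}}"
  let ?P = "\<lambda>e. permutations_of_set (e - {i})"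
  let ?f = "\<lambda>is. 1 / fact (m - 1) * (\<Prod>j\<leftarrow>is. x $ j)"
  have edge: "finite e" "card e = m" "e \<subseteq> {..<n}" if "e \<in> E" for e
    using unif that finite_subset unfolding uniform_hypergraph_def by auto
  have finL: "finite ?L"
    using finite_lists_length_eq[of "{..<n}" "m - 1"] by (simp add: conj_commute)
  have "tensor_apply m n (adjacency_tensor m E) x i
      = (\<Sum>is\<in>?L. if insert i (set is) \<in> E then ?f is else 0)"
    unfolding tensor_apply_def adjacency_tensor_def by (intro sum.cong) auto
  also have "\<dots> = sum ?f {is \<in> ?L. insert i (set is) \<in> E}"
    using finL by (rule sum.inter_filter[symmetric])
  \<comment> \<open>Group the index lists by the edge that they form together with
    \<open>i\<close>.\<close>
  also have "{is \<in> ?L. insert i (set is) \<in> E} = (\<Union>e\<in>{e \<in> E. i \<in> e}. ?P e)"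
  proof -
    have "{is \<in> ?L. insert i (set is) \<in> E}
        = (\<Union>e\<in>{e \<in> E. i \<in> e}. {is. length is = m - 1 \<and> insert i (set is) = e})"
      using edge(3) by fastforce
    also have "\<dots> = (\<Union>e\<in>{e \<in> E. i \<in> e}. ?P e)"
      using lists_completing_edge[OF edge(1,2)] by (intro SUP_cong) simp_all
    finally show ?thesis .
  qed
  also have "sum ?f \<dots> = (\<Sum>e | e \<in> E \<and> i \<in> e. sum ?f (?P e))"
  proof (intro sum.UNION_disjoint ballI impI)
    fix e e'
    assume "e \<in> {e \<in> E. i \<in> e}" "e' \<in> {e \<in> E. i \<in> e}" "e \<noteq> e'"
    \<comment> \<open>Both edges contain \<open>i\<close>, so removing it keeps them
      distinct.\<close>
    then have "e - {i} \<noteq> e' - {i}"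
      by blast
    then show "?P e \<inter> ?P e' = {}"
      by (metis disjoint_iff permutations_of_setD(1))
  qed (use fin in simp_all)
  also have "\<dots> = (\<Sum>e | e \<in> E \<and> i \<in> e. \<Prod>j\<in>e - {i}. x $ j)"
  proof (rule sum.cong)
    fix e
    assume "e \<in> {e \<in> E. i \<in> e}"
    then have e: "finite (e - {i})" "card (e - {i}) = m - 1"
      using edge by simp_all
    have "sum ?f (?P e) = (\<Sum>is\<in>?P e. 1 / fact (m - 1) * (\<Prod>j\<in>e - {i}. x $ j))"
    proof (rule sum.cong)
      fix xs
      assume "xs \<in> ?P e"
      then have "set xs = e - {i}" "distinct xs"
        by (simp_all add: permutations_of_set_def)
      then show "?f xs = 1 / fact (m - 1) * (\<Prod>j\<in>e - {i}. x $ j)"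
        using prod.distinct_set_conv_list[of xs "\<lambda>j. x $ j"] by simp
    qed simp
    then show "sum ?f (?P e) = (\<Prod>j\<in>e - {i}. x $ j)"
      using e by simp
  qed simp
  finally show ?thesis .
qed

lemma degree_tensor_apply:
  assumes m: "0 < m" and i: "i < n"
  shows "tensor_apply m n (degree_tensor m E) x i = of_nat (degree E i) * x $ i ^ (m - 1)"
proof -
  let ?L = "{is. length is = m - 1 \<and> set is \<subseteq> {..<n}}"
  have finL: "finite ?L"
    using finite_lists_length_eq[of "{..<n}" "m - 1"] by (simp add: conj_commute)
  \<comment> \<open>Only the constant list survives in the sum, since the head of
    \<open>i # is\<close> is always \<open>i\<close>.\<close>
  have "i # is = replicate m i \<longleftrightarrow> is = replicate (m - 1) i" for "is"
    using m by (cases m) auto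
  then have "tensor_apply m n (degree_tensor m E) x i
      = (\<Sum>is\<in>?L. if replicate (m - 1) i = is then of_nat (degree E i) * (\<Prod>j\<leftarrow>is. x $ j) else 0)"
    unfolding tensor_apply_def degree_tensor_def by (intro sum.cong) auto
  moreover have "replicate (m - 1) i \<in> ?L"
    using i by (simp add: subset_iff)
  ultimately show ?thesis
    using finL by (simp add: prod_list_replicate)
qed

lemma laplacian_tensor_apply:
  assumes "uniform_hypergraph m n E" "finite E" "0 < m" "i < n"
  shows "tensor_apply m n (laplacian_tensor m E) x i = of_nat (degree E i) * x $ i ^ (m - 1)
    - (\<Sum>e | e \<in> E \<and> i \<in> e. \<Prod>j\<in>e - {i}. x $ j)"
proof -
  have "tensor_apply m n (laplacian_tensor m E) x i
      = tensor_apply m n (degree_tensor m E) x i - tensor_apply m n (adjacency_tensor m E) x i"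
    unfolding tensor_apply_def laplacian_tensor_def by (simp add: left_diff_distrib sum_subtractf)
  then show ?thesis
    using assms by (simp add: degree_tensor_apply adjacency_tensor_apply)
qed

section \<open>Rigidity of real solutions\<close>

lemma abs_factor_eq_1:
  fixes z :: "'a \<Rightarrow> real"
  assumes "finite e" and "\<And>j. j \<in> e \<Longrightarrow> \<bar>z j\<bar> \<le> 1" and "\<bar>prod z e\<bar> = 1" and "v \<in> e"
  shows "\<bar>z v\<bar> = 1"
proof -
  \<comment> \<open>The remaining factors have absolute value at most 1, so they cannot make up for
    a deficit at \<open>v\<close>.\<close>
  have "1 = \<bar>z v\<bar> * (\<Prod>j\<in>e - {v}. \<bar>z j\<bar>)"
    using assms by (simp add: prod.remove[of e v] abs_mult abs_prod)
  also have "\<dots> \<le> \<bar>z v\<bar> * 1"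
    using assms(2) by (intro mult_left_mono prod_le_1) auto
  finally show ?thesis
    using assms(2)[OF assms(4)] by simp
qed

text \<open>Multiplying the equation at \<open>i\<close> by \<open>z i\<close> turns it into
  \<open>(\<Sum>e\<ni>i. 1 - prod z e) = 0\<close>, a vanishing sum of nonnegative terms.\<close>

lemma edge_prod_eq_1_if_abs_eq_1:
  fixes z :: "nat \<Rightarrow> real"
  assumes unif: "uniform_hypergraph m n E" and fin: "finite E" and m: "even m" "0 < m"
    and le: "\<And>j. j < n \<Longrightarrow> \<bar>z j\<bar> \<le> 1"
    and eq: "real (degree E i) * z i ^ (m - 1) = (\<Sum>e | e \<in> E \<and> i \<in> e. \<Prod>j\<in>e - {i}. z j)"
    and i: "\<bar>z i\<bar> = 1" and e: "e \<in> E" "i \<in> e"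
  shows "prod z e = 1"
proof -
  let ?S = "{e \<in> E. i \<in> e}"
  have edge: "finite f" "f \<subseteq> {..<n}" if "f \<in> E" for f
    using unif that finite_subset unfolding uniform_hypergraph_def by auto
  \<comment> \<open>Evenness of \<open>m\<close> enters here: \<open>\<bar>z i\<bar> = 1\<close>
    gives \<open>z i ^ m = 1\<close> whatever the sign of \<open>z i\<close>.\<close>
  have "z i * z i ^ (m - 1) = 1"
    using i m power_even_abs[of m "z i"] by (cases m) auto
  then have "real (card ?S) = z i * (real (degree E i) * z i ^ (m - 1))"
    by (simp add: degree_def algebra_simps)
  also have "\<dots> = (\<Sum>f\<in>?S. z i * (\<Prod>j\<in>f - {i}. z j))"
    unfolding eq by (rule sum_distrib_left)
  also have "\<dots> = (\<Sum>f\<in>?S. prod z f)"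
    using edge by (intro sum.cong) (auto simp: prod.remove)
  finally have "(\<Sum>f\<in>?S. 1 - prod z f) = 0"
    by (simp add: sum_subtractf)
  moreover have "0 \<le> 1 - prod z f" if "f \<in> ?S" for f
  proof -
    have "\<bar>prod z f\<bar> \<le> 1"
      unfolding abs_prod using edge that le by (intro prod_le_1) auto
    then show ?thesis by linarith
  qed
  ultimately have "\<forall>f\<in>?S. 1 - prod z f = 0"
    using fin by (subst (asm) sum_nonneg_eq_0_iff) auto
  then show ?thesis
    using e by simp
qed

text \<open>A maximum principle: absolute value 1 is attained after scaling, and it spreads from a
  vertex to every edge through it, hence along paths to all vertices. The divisor \<open>M\<close>
  is an entry of \<open>y\<close> of maximal absolute value, taken with its sign; it is nonzero
  because \<open>y\<close> is.\<close>

lemma real_eigenvector_abs_eq: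
  fixes y :: "nat \<Rightarrow> real"
  assumes unif: "uniform_hypergraph m n E" and conn: "connected_hypergraph n E"
    and fin: "finite E" and m: "even m" "0 < m"
    and eq: "\<And>i. i < n \<Longrightarrow>
      real (degree E i) * y i ^ (m - 1) = (\<Sum>e | e \<in> E \<and> i \<in> e. \<Prod>j\<in>e - {i}. y j)"
    and nz: "k < n" "y k \<noteq> 0"
  obtains M where "M \<noteq> 0" and "\<And>i. i < n \<Longrightarrow> \<bar>y i / M\<bar> = 1"
    and "\<And>e. e \<in> E \<Longrightarrow> (\<Prod>i\<in>e. y i / M) = 1"
proof -
  have edge: "finite f" "f \<subseteq> {..<n}" "card f = m" if "f \<in> E" for f
    using unif that finite_subset unfolding uniform_hypergraph_def by auto
  have "Max ((\<lambda>i. \<bar>y i\<bar>) ` {..<n}) \<in> (\<lambda>i. \<bar>y i\<bar>) ` {..<n}"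
    using nz(1) by (intro Max_in) auto
  then obtain a where a: "a < n" "\<bar>y a\<bar> = Max ((\<lambda>i. \<bar>y i\<bar>) ` {..<n})"
    by auto
  have max: "\<bar>y i\<bar> \<le> \<bar>y a\<bar>" if "i < n" for i
    unfolding a(2) using that by (intro Max_ge) auto
  with nz have M: "y a \<noteq> 0" by force
  define z where "z i = y i / y a" for i
  have le: "\<bar>z i\<bar> \<le> 1" if "i < n" for i
    using max[OF that] M by (simp add: z_def)
  \<comment> \<open>Both sides are homogeneous of degree \<open>m - 1\<close>, so the equation
    survives the scaling.\<close>
  have eqz: "real (degree E i) * z i ^ (m - 1) = (\<Sum>e | e \<in> E \<and> i \<in> e. \<Prod>j\<in>e - {i}. z j)"
    if "i < n" for i
  proof -
    have "(\<Sum>e | e \<in> E \<and> i \<in> e. \<Prod>j\<in>e - {i}. z j)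
        = (\<Sum>e | e \<in> E \<and> i \<in> e. (\<Prod>j\<in>e - {i}. y j) / y a ^ (m - 1))"
      using edge by (intro sum.cong) (auto simp: z_def prod_dividef)
    then show ?thesis
      using eq[OF that] by (simp add: z_def power_divide flip: sum_divide_distrib)
  qed
  note prod_1 = edge_prod_eq_1_if_abs_eq_1[OF unif fin m le eqz]
  have abs_1: "\<bar>z i\<bar> = 1" if "i < n" for i
  proof -
    have "(a, i) \<in> (adjacent_rel E)\<^sup>*"
      using conn a(1) that unfolding connected_hypergraph_def by blast
    then show ?thesis
    proof induction
      case base
      show ?case using M by (simp add: z_def)
    next
      case (step u v)
      then obtain e where e: "e \<in> E" "u \<in> e" "v \<in> e"
        unfolding adjacent_rel_def by blast
      then have "u < n" using edge(2) by blast
      \<comment> \<open>By induction \<open>u\<close> is extremal, so the product over the edge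
        shared by \<open>u\<close> and \<open>v\<close> is 1. No factor of it can then be smaller
        than 1 in absolute value, in particular not the one at \<open>v\<close>.\<close>
      then have "prod z e = 1"
        using prod_1 step.IH e by blast
      then show ?case
        using edge(1,2) e le by (intro abs_factor_eq_1[of e z v]) auto
    qed
  qed
  show ?thesis
  proof
    show "y a \<noteq> 0" by fact
    show "\<bar>y i / y a\<bar> = 1" if "i < n" for i
      using abs_1[OF that] unfolding z_def .
    show "(\<Prod>i\<in>e. y i / y a) = 1" if e: "e \<in> E" for e
    proof -
      \<comment> \<open>Edges are nonempty because \<open>m > 0\<close>; any vertex of
        \<open>e\<close> is extremal and yields the edge product.\<close>
      have "e \<noteq> {}" using edge[OF e] m by auto
      then obtain u where u: "u \<in> e" by blast
      then have "u < n" using edge(2) e by blast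
      then show ?thesis
        using prod_1[OF _ _ abs_1 e u] by (simp add: z_def)
    qed
  qed
qed

section \<open>Sign vectors\<close>

text \<open>The isomorphism from the additive group of the two-element field onto
  \<open>{1, -1}\<close>. The target ring is left open because signs occur both as reals, in the
  rigidity argument, and as complex entries of eigenvectors.\<close>

definition bit_sign :: "bit \<Rightarrow> 'a::ring_1" where
  "bit_sign b = (if b = 0 then 1 else -1)"

lemma bit_sign_0 [simp]: "bit_sign 0 = 1"
  by (simp add: bit_sign_def)

lemma bit_sign_mult_self [simp]: "bit_sign b * bit_sign b = 1"
  by (simp add: bit_sign_def)

lemma bit_sign_add: "bit_sign (a + b) = bit_sign a * bit_sign b"
  by (cases a; cases b) (simp_all add: bit_sign_def)

lemma bit_sign_sum: "bit_sign (sum f A) = (\<Prod>i\<in>A. bit_sign (f i) :: 'a::comm_ring_1)"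
  by (induction A rule: infinite_finite_induct) (simp_all add: bit_sign_add del: add_bit_eq_xor)

lemma bit_sign_eq_iff [simp]: "(bit_sign a :: 'a::ring_char_0) = bit_sign b \<longleftrightarrow> a = b"
  by (cases a; cases b) (simp_all add: bit_sign_def)

lemma bit_sign_eq_1_iff [simp]: "(bit_sign b :: 'a::ring_char_0) = 1 \<longleftrightarrow> b = 0"
  by (cases b) (simp_all add: bit_sign_def)

lemma of_real_bit_sign [simp]: "of_real (bit_sign b) = bit_sign b"
  by (simp add: bit_sign_def)

lemma bit_sign_power_odd: "odd k \<Longrightarrow> bit_sign b ^ k = bit_sign b"
  by (simp add: bit_sign_def)

lemma bit_vec_add_self: "s \<in> carrier_vec n \<Longrightarrow> s + s = 0\<^sub>v n" for s :: "bit vec"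
  by (intro eq_vecI) auto

definition sign_vec :: "bit vec \<Rightarrow> complex vec" where
  "sign_vec s = map_vec bit_sign s"

lemma sign_vec_carrier [simp]: "sign_vec s \<in> carrier_vec n \<longleftrightarrow> s \<in> carrier_vec n"
  by (simp add: sign_vec_def)

lemma dim_sign_vec [simp]: "dim_vec (sign_vec s) = dim_vec s"
  by (simp add: sign_vec_def)

lemma sign_vec_index [simp]: "i < dim_vec s \<Longrightarrow> sign_vec s $ i = bit_sign (s $ i)"
  by (simp add: sign_vec_def)

lemma sign_vec_inj: "sign_vec s = sign_vec t \<Longrightarrow> s = t"
proof (intro eq_vecI)
  assume eq: "sign_vec s = sign_vec t"
  show dim: "dim_vec s = dim_vec t"
    using arg_cong[OF eq, of dim_vec] by simp
  show "s $ i = t $ i" if "i < dim_vec t" for i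
    using arg_cong[OF eq, of "\<lambda>v. v $ i"] dim that by simp
qed

lemma hadamard_sign_vec:
  assumes "s \<in> carrier_vec n" "t \<in> carrier_vec n"
  shows "hadamard n (sign_vec s) (sign_vec t) = sign_vec (s + t)"
  using assms by (intro eq_vecI) (auto simp: hadamard_def bit_sign_add)

lemma sign_vec_zero: "sign_vec (0\<^sub>v n) = vec n (\<lambda>_. 1)"
  by (intro eq_vecI) auto

lemma proj_point_smult:
  assumes "c \<noteq> 0"
  shows "proj_point (c \<cdot>\<^sub>v v) = proj_point v"
proof (intro equalityI subsetI)
  fix w
  assume "w \<in> proj_point (c \<cdot>\<^sub>v v)"
  then show "w \<in> proj_point v"
    using assms unfolding proj_point_def by (auto simp: smult_smult_assoc intro: exI[of _ "_ * c"])
next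
  fix w
  assume "w \<in> proj_point v"
  then obtain d where d: "d \<noteq> 0" "w = d \<cdot>\<^sub>v v"
    unfolding proj_point_def by blast
  then have "w = (d / c) \<cdot>\<^sub>v (c \<cdot>\<^sub>v v)" "d / c \<noteq> 0"
    using assms by (simp_all add: smult_smult_assoc)
  then show "w \<in> proj_point (c \<cdot>\<^sub>v v)"
    unfolding proj_point_def by blast
qed

text \<open>The first coordinate of \<open>sign_vec s\<close> is already 1, which forces the scalar
  of any other normalised multiple to be 1. Thus \<open>s\<close> can be recovered from its
  projective point.\<close>

lemma sign_reps_sign_vec:
  assumes s: "s \<in> carrier_vec n" "s $ 0 = 0" and n: "0 < n"
  shows "sign_reps n (proj_point (sign_vec s)) = {sign_vec s}"
proof (intro equalityI subsetI)
  fix v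
  assume "v \<in> sign_reps n (proj_point (sign_vec s))"
  then obtain c where "v = c \<cdot>\<^sub>v sign_vec s" "v $ 0 = 1"
    unfolding sign_reps_def proj_point_def by blast
  then show "v \<in> {sign_vec s}"
    using s n by auto
next
  fix v
  assume "v \<in> {sign_vec s}"
  moreover have "sign_vec s \<in> proj_point (sign_vec s)"
    unfolding proj_point_def by (auto intro: exI[of _ 1])
  ultimately show "v \<in> sign_reps n (proj_point (sign_vec s))"
    using s n by (auto simp: sign_reps_def bit_sign_def)
qed

lemma hadamard_point_sign_vec:
  assumes "s \<in> carrier_vec n" "s $ 0 = 0" "t \<in> carrier_vec n" "t $ 0 = 0" "0 < n"
  shows "hadamard_point n (proj_point (sign_vec s)) (proj_point (sign_vec t))
    = proj_point (sign_vec (s + t))"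
  using assms by (simp add: hadamard_point_def sign_reps_sign_vec hadamard_sign_vec)

section \<open>The space of first Laplacian H-eigenvectors\<close>

lemma incidence_mat_carrier: "incidence_mat n es \<in> carrier_mat (length es) n"
  by (simp add: incidence_mat_def)

text \<open>Row \<open>k\<close> is the indicator vector of the edge \<open>es ! k\<close>, so its
  scalar product with \<open>s\<close> is an edge sum. Over \<open>bit\<close>, the kernel condition
  says that \<open>sign_vec s\<close> has an even number of minus signs on each edge.\<close>

lemma mat_kernel_incidence_mat_iff:
  fixes s :: "'a::comm_ring_1 vec"
  assumes "\<And>e. e \<in> set es \<Longrightarrow> e \<subseteq> {..<n}"
  shows "s \<in> mat_kernel (incidence_mat n es) \<longleftrightarrow>
    s \<in> carrier_vec n \<and> (\<forall>e\<in>set es. (\<Sum>v\<in>e. s $ v) = 0)"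
proof -
  have row: "(incidence_mat n es *\<^sub>v s) $ k = (\<Sum>v\<in>es ! k. s $ v)"
    if s: "s \<in> carrier_vec n" and k: "k < length es" for k
  proof -
    have "(incidence_mat n es *\<^sub>v s) $ k = (\<Sum>v<n. (if v \<in> es ! k then s $ v else 0))"
      using s k by (auto simp: incidence_mat_def scalar_prod_def lessThan_atLeast0 intro!: sum.cong)
    also have "\<dots> = (\<Sum>v\<in>{v \<in> {..<n}. v \<in> es ! k}. s $ v)"
      by (rule sum.inter_filter[symmetric]) simp
    also have "{v \<in> {..<n}. v \<in> es ! k} = es ! k"
      using assms[of "es ! k"] k by auto
    finally show ?thesis .
  qed
  show ?thesis
    using carrier_matD[OF incidence_mat_carrier[of n es, where ?'a = 'a]]
    unfolding mat_kernel[OF incidence_mat_carrier] all_set_conv_all_nth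
    by (auto simp: row vec_eq_iff simp del: index_mult_mat_vec)
qed

text \<open>Adding the all-ones vector to \<open>s\<close> negates \<open>sign_vec s\<close> and so
  gives the same projective point. The condition on coordinate 0 selects one of the two, namely the
  one whose sign vector starts with 1.\<close>

definition sign_space :: "nat \<Rightarrow> nat set list \<Rightarrow> bit vec set" where
  "sign_space n es = {s \<in> mat_kernel (incidence_mat n es). s $ 0 = 0}"

text \<open>The signs on an edge multiply to 1, so omitting \<open>i\<close> leaves the sign at
  \<open>i\<close>. All \<open>degree E i\<close> summands of the adjacency part therefore equal
  that sign, and so does its power with the odd exponent \<open>m - 1\<close>.\<close>

lemma first_laplacian_eigenvector_sign_vec:
  assumes unif: "uniform_hypergraph m n (set es)" and m: "even m" "0 < m" and n: "0 < n"
    and s: "s \<in> mat_kernel (incidence_mat n es)"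
  shows "first_laplacian_eigenvector m n (set es) (sign_vec s)"
proof -
  have edge: "finite e" "e \<subseteq> {..<n}" if "e \<in> set es" for e
    using unif that finite_subset unfolding uniform_hypergraph_def by auto
  have s: "s \<in> carrier_vec n" and sum_0: "\<And>e. e \<in> set es \<Longrightarrow> (\<Sum>v\<in>e. s $ v) = 0"
    using s mat_kernel_incidence_mat_iff[of es n s] edge(2) by auto
  have "tensor_apply m n (laplacian_tensor m (set es)) (sign_vec s) i = 0" if i: "i < n" for i
  proof -
    have "(\<Prod>j\<in>e - {i}. sign_vec s $ j) = bit_sign (s $ i)" if e: "e \<in> set es" "i \<in> e" for e
    proof -
      have "(\<Prod>j\<in>e - {i}. sign_vec s $ j) = bit_sign (\<Sum>j\<in>e - {i}. s $ j)"
        unfolding bit_sign_sum using edge(2)[OF e(1)] s by (intro prod.cong) auto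
      \<comment> \<open>The full edge sum vanishes, and \<open>- s $ i = s $ i\<close> in
        characteristic 2.\<close>
      also have "(\<Sum>j\<in>e - {i}. s $ j) = s $ i"
        using sum_0[OF e(1)] edge(1)[OF e(1)] e(2) by (simp add: sum_diff1)
      finally show ?thesis .
    qed
    then show ?thesis
      using m s i by (simp add: laplacian_tensor_apply[OF unif] degree_def bit_sign_power_odd)
  qed
  moreover have "sign_vec s \<noteq> 0\<^sub>v n"
  proof
    assume "sign_vec s = 0\<^sub>v n"
    then have "sign_vec s $ 0 = 0"
      using n by simp
    then show False
      using s n by (simp add: bit_sign_def split: if_splits)
  qed
  ultimately show ?thesis
    using s unfolding first_laplacian_eigenvector_def by simp
qed

lemma multiple_of_real_sign_vec: "s \<in> carrier_vec n \<Longrightarrow> multiple_of_real n (sign_vec s)"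
  unfolding multiple_of_real_def
  by (intro exI[of _ 1] bexI[of _ "sign_vec s"]) (auto simp: bit_sign_def)

text \<open>Homogeneity removes the complex factor \<open>d\<close>, the maximum principle turns the
  real vector into a multiple of a sign vector, and the sign at vertex 0 is moved into the
  scalar.\<close>

lemma real_first_laplacian_eigenvector_is_sign_vec:
  assumes unif: "uniform_hypergraph m n (set es)" and conn: "connected_hypergraph n (set es)"
    and m: "even m" "0 < m"
    and x: "first_laplacian_eigenvector m n (set es) x" "multiple_of_real n x"
  obtains c s where "c \<noteq> 0" "s \<in> sign_space n es" "x = c \<cdot>\<^sub>v sign_vec s"
proof -
  have edge: "finite e" "e \<subseteq> {..<n}" "card e = m" if "e \<in> set es" for e
    using unif that finite_subset unfolding uniform_hypergraph_def by auto
  obtain d y where y: "y \<in> carrier_vec n" "\<And>i. i < n \<Longrightarrow> y $ i \<in> \<real>" and xy: "x = d \<cdot>\<^sub>v y"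
    using x(2) unfolding multiple_of_real_def by blast
  define Y where "Y i = Re (y $ i)" for i
  have Y: "x $ i = d * of_real (Y i)" if "i < n" for i
    using that y unfolding xy Y_def by simp
  have x0: "x \<in> carrier_vec n" "x \<noteq> 0\<^sub>v n"
    using x(1) unfolding first_laplacian_eigenvector_def by auto
  then obtain k where k: "k < n" "x $ k \<noteq> 0"
    by (metis carrier_vecD eq_vecI index_zero_vec)
  then have d: "d \<noteq> 0" and Yk: "Y k \<noteq> 0"
    using Y by auto
  have eq: "real (degree (set es) i) * Y i ^ (m - 1)
      = (\<Sum>e | e \<in> set es \<and> i \<in> e. \<Prod>j\<in>e - {i}. Y j)" if i: "i < n" for i
  proof -
    have "(\<Prod>j\<in>e - {i}. x $ j) = d ^ (m - 1) * of_real (\<Prod>j\<in>e - {i}. Y j)"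
      if e: "e \<in> set es" "i \<in> e" for e
    proof -
      have "(\<Prod>j\<in>e - {i}. x $ j) = (\<Prod>j\<in>e - {i}. d * of_real (Y j))"
        using edge(2)[OF e(1)] Y by (intro prod.cong) auto
      then show ?thesis
        using edge[OF e(1)] e(2) by (simp add: prod.distrib)
    qed
    then have "(\<Sum>e | e \<in> set es \<and> i \<in> e. \<Prod>j\<in>e - {i}. x $ j)
        = (\<Sum>e | e \<in> set es \<and> i \<in> e. d ^ (m - 1) * of_real (\<Prod>j\<in>e - {i}. Y j))"
      by (intro sum.cong) auto
    also have "\<dots> = d ^ (m - 1) * of_real (\<Sum>e | e \<in> set es \<and> i \<in> e. \<Prod>j\<in>e - {i}. Y j)"
      by (simp add: sum_distrib_left)
    \<comment> \<open>Both sides of the eigenvector equation carry the factor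
      \<open>d ^ (m - 1)\<close>, which is then cancelled.\<close>
    finally have "d ^ (m - 1) * of_real (real (degree (set es) i) * Y i ^ (m - 1))
        = d ^ (m - 1) * of_real (\<Sum>e | e \<in> set es \<and> i \<in> e. \<Prod>j\<in>e - {i}. Y j)"
      using x(1) i m laplacian_tensor_apply[OF unif, of i x] Y[OF i]
      unfolding first_laplacian_eigenvector_def by (simp add: power_mult_distrib mult.left_commute)
    then have "(of_real (real (degree (set es) i) * Y i ^ (m - 1)) :: complex)
        = of_real (\<Sum>e | e \<in> set es \<and> i \<in> e. \<Prod>j\<in>e - {i}. Y j)"
      using d by simp
    then show ?thesis
      unfolding of_real_eq_iff .
  qed
  obtain M where M: "M \<noteq> 0" "\<And>i. i < n \<Longrightarrow> \<bar>Y i / M\<bar> = 1"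
    "\<And>e. e \<in> set es \<Longrightarrow> (\<Prod>i\<in>e. Y i / M) = 1"
    using real_eigenvector_abs_eq[OF unif conn _ m eq k(1) Yk] by auto
  define w where "w i = Y i / M" for i
  have w: "w i = 1 \<or> w i = - 1" if "i < n" for i
    using M(2)[OF that] unfolding w_def by linarith
  have n: "0 < n" using k by simp
  \<comment> \<open>Record where the sign differs from the one at vertex 0. This makes
    \<open>s $ 0 = 0\<close>, at the price of a factor \<open>w 0\<close> in each
    coordinate.\<close>
  define s where "s = vec n (\<lambda>i. if w i = w 0 then 0 else 1 :: bit)"
  have sgn: "bit_sign (s $ i) = w i * w 0" if "i < n" for i
    using w[OF that] w[OF n] that by (auto simp: s_def bit_sign_def)
  have "(\<Sum>i\<in>e. s $ i) = 0" if e: "e \<in> set es" for e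
  proof -
    have "(bit_sign (\<Sum>i\<in>e. s $ i) :: real) = (\<Prod>i\<in>e. w i * w 0)"
      unfolding bit_sign_sum using sgn edge(2)[OF e] by (intro prod.cong) auto
    also have "\<dots> = (\<Prod>i\<in>e. w i) * w 0 ^ m"
      using edge(3)[OF e] by (simp add: prod.distrib)
    also have "\<dots> = w 0 ^ m"
      using M(3)[OF e] by (simp add: w_def)
    \<comment> \<open>The normalising factor occurs once per vertex of the edge, an even number of
      times.\<close>
    also have "\<dots> = 1"
      using w[OF n] m by auto
    finally show ?thesis by simp
  qed
  then have "s \<in> sign_space n es"
    using n edge(2) unfolding sign_space_def by (simp add: mat_kernel_incidence_mat_iff s_def)
  \<comment> \<open>The scalar undoes all three normalisations; the two factors \<open>w 0\<close>
    cancel because \<open>w 0 * w 0 = 1\<close>.\<close>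
  moreover have "x = (d * of_real (M * w 0)) \<cdot>\<^sub>v sign_vec s"
  proof (intro eq_vecI)
    fix i
    assume "i < dim_vec ((d * of_real (M * w 0)) \<cdot>\<^sub>v sign_vec s)"
    then have i: "i < n" by (simp add: s_def)
    have "Y i = M * w 0 * bit_sign (s $ i)"
    proof -
      have "M * w 0 * bit_sign (s $ i) = M * w i * (w 0 * w 0)"
        using sgn[OF i] by simp
      also have "\<dots> = Y i"
        using w[OF n] M(1) by (auto simp: w_def[of i])
      finally show ?thesis by simp
    qed
    then have "x $ i = d * of_real (M * w 0 * bit_sign (s $ i))"
      using Y[OF i] by simp
    then show "x $ i = ((d * of_real (M * w 0)) \<cdot>\<^sub>v sign_vec s) $ i"
      using i by (simp add: s_def)
  qed (use x0 in \<open>simp add: s_def\<close>)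
  moreover have "d * of_real (M * w 0) \<noteq> 0"
    using d M(1) w[OF n] by auto
  ultimately show ?thesis
    using that by blast
qed

section \<open>Projective points as normalised kernel vectors\<close>

lemma HPV0_eq_sign_space:
  assumes "uniform_hypergraph m n (set es)" "connected_hypergraph n (set es)"
    and "even m" "0 < m" "0 < n"
  shows "HPV0 m n (set es) = (\<lambda>s. proj_point (sign_vec s)) ` sign_space n es"
proof (intro equalityI subsetI)
  fix P
  assume "P \<in> HPV0 m n (set es)"
  then obtain x where x: "first_laplacian_eigenvector m n (set es) x" "multiple_of_real n x"
    and P: "P = proj_point x"
    unfolding HPV0_def by blast
  obtain c s where "c \<noteq> 0" "s \<in> sign_space n es" "x = c \<cdot>\<^sub>v sign_vec s"
    using real_first_laplacian_eigenvector_is_sign_vec[OF assms(1-4) x] .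
  then show "P \<in> (\<lambda>s. proj_point (sign_vec s)) ` sign_space n es"
    using P by (simp add: proj_point_smult)
next
  fix P
  assume "P \<in> (\<lambda>s. proj_point (sign_vec s)) ` sign_space n es"
  then obtain s where s: "s \<in> mat_kernel (incidence_mat n es)" and P: "P = proj_point (sign_vec s)"
    unfolding sign_space_def by blast
  have "s \<in> carrier_vec n"
    using s mat_kernel_carrier[OF incidence_mat_carrier] by blast
  then show "P \<in> HPV0 m n (set es)"
    using first_laplacian_eigenvector_sign_vec[OF assms(1,3,4,5) s] multiple_of_real_sign_vec P
    unfolding HPV0_def by blast
qed

lemma sign_space_carrier: "s \<in> sign_space n es \<Longrightarrow> s \<in> carrier_vec n \<and> s $ 0 = 0"
  using mat_kernel_carrier[OF incidence_mat_carrier] unfolding sign_space_def by blast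

lemma inj_on_proj_point_sign_vec:
  assumes "0 < n"
  shows "inj_on (\<lambda>s. proj_point (sign_vec s)) (sign_space n es)"
proof (rule inj_onI)
  fix s t
  assume "s \<in> sign_space n es" "t \<in> sign_space n es"
    and "proj_point (sign_vec s) = proj_point (sign_vec t)"
  then have "{sign_vec s} = {sign_vec t}"
    using sign_reps_sign_vec assms sign_space_carrier by metis
  then show "s = t"
    by (auto dest: sign_vec_inj)
qed

section \<open>The linear structure on the set of points\<close>

lemma zero_in_sign_space: "0 < n \<Longrightarrow> 0\<^sub>v n \<in> sign_space n es"
  using incidence_mat_carrier[of n es, where ?'a = bit]
  unfolding sign_space_def by (auto intro!: mat_kernelI)

lemma add_in_sign_space:
  assumes "s \<in> sign_space n es" "t \<in> sign_space n es" "0 < n"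
  shows "s + t \<in> sign_space n es"
  using assms mat_kernel_add[OF incidence_mat_carrier, of s n es t] sign_space_carrier[of s n es]
    sign_space_carrier[of t n es]
  unfolding sign_space_def by auto

text \<open>The operations are transported along \<open>s\<close> to
  \<open>proj_point (sign_vec s)\<close>, under which the Hadamard product becomes addition in
  \<open>sign_space n es\<close>. The module axioms thus reduce to identities between bit
  vectors.\<close>

lemma vectorspace_HPV0_space:
  assumes "uniform_hypergraph m n (set es)" "connected_hypergraph n (set es)"
    and "even m" "0 < m" and n: "0 < n"
  shows "vectorspace class_ring (HPV0_space m n (set es))"
proof -
  let ?pt = "\<lambda>s. proj_point (sign_vec s)"
  let ?V = "HPV0_space m n (set es)"
  have carrier: "carrier ?V = ?pt ` sign_space n es"
    using HPV0_eq_sign_space[OF assms] by (simp add: HPV0_space_def)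
  have add: "add ?V (?pt s) (?pt t) = ?pt (s + t)"
    if "s \<in> sign_space n es" "t \<in> sign_space n es" for s t
    using that n hadamard_point_sign_vec sign_space_carrier by (simp add: HPV0_space_def)
  have zero: "zero ?V = ?pt (0\<^sub>v n)"
    by (simp add: HPV0_space_def sign_vec_zero)
  have smult: "smult ?V a P = (if a = 0 then ?pt (0\<^sub>v n) else P)" for a P
    by (simp add: HPV0_space_def sign_vec_zero)
  note K = zero_in_sign_space[OF n] add_in_sign_space[OF _ _ n]
  have vec: "s \<in> carrier_vec n" if "s \<in> sign_space n es" for s
    using sign_space_carrier that by blast
  have comm: "s + t = t + s" if "s \<in> sign_space n es" "t \<in> sign_space n es" for s t
    using that by (intro comm_add_vec[of _ n] vec)
  have assoc: "s + t + u = s + (t + u)"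
    if "s \<in> sign_space n es" "t \<in> sign_space n es" "u \<in> sign_space n es" for s t u
    using that by (intro assoc_add_vec[of _ n] vec)
  \<comment> \<open>Being its own negative gives each vector an additive inverse, and it is also
    what distributivity over the scalar sum \<open>1 + 1 = 0\<close> amounts to.\<close>
  have self: "s + s = 0\<^sub>v n" and zero_add: "0\<^sub>v n + s = s" and add_zero: "s + 0\<^sub>v n = s"
    if "s \<in> sign_space n es" for s
    using vec[OF that] by (simp_all add: bit_vec_add_self)
  have "Module.module class_ring ?V"
  proof (rule module_criteria, goal_cases)
    case 1
    show ?case by (rule class_cring.is_cring)
  next
    case 2
    show ?case by (simp add: carrier zero K)
  next
    case 3
    show ?case by (auto simp: carrier add K)
  next
    case 4
    show ?case by (auto simp: carrier zero add self intro!: bexI[rotated])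
  next
    case 5
    show ?case by (auto simp: carrier smult K)
  next
    case 6
    show ?case by (clarsimp simp: carrier add) (simp add: comm)
  next
    case 7
    show ?case by (clarsimp simp: carrier add K) (simp add: assoc)
  next
    case 8
    show ?case by (auto simp: carrier zero add K add_zero)
  next
    case 9
    show ?case by (auto simp: smult)
  next
    case 10
    show ?case by (auto simp: smult)
  next
    case 11
    show ?case by (auto simp: carrier smult add K self zero_add add_zero)
  next
    case 12
    show ?case by (auto simp: carrier smult add K self)
  qed
  then show ?thesis
    by (rule vectorspace.intro[OF _ class_field])
qed

text \<open>A path between the distinct vertices 0 and 1 has a first step, and that step lies in an
  edge through 0. Such an edge yields both \<open>m > 0\<close> and the lower bound on the
  rank.\<close>

lemma edge_exists:
  assumes "connected_hypergraph n E" "2 \<le> n"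
  obtains e where "e \<in> E" "0 \<in> e"
proof -
  have "(0, 1) \<in> (adjacent_rel E)\<^sup>*"
    using assms unfolding connected_hypergraph_def by simp
  then show ?thesis
    by (cases rule: converse_rtranclE) (auto simp: adjacent_rel_def intro: that)
qed

text \<open>As \<open>m\<close> is even, the all-ones vector lies in the kernel of the incidence matrix;
  adding it flips the first coordinate.\<close>

lemma card_mat_kernel_incidence_mat:
  assumes unif: "uniform_hypergraph m n (set es)" and m: "even m" and n: "0 < n"
  shows "card (mat_kernel (incidence_mat n es :: bit mat)) = 2 * card (sign_space n es)"
proof -
  let ?A = "incidence_mat n es :: bit mat"
  let ?u = "vec n (\<lambda>_. 1) :: bit vec"
  let ?flip = "\<lambda>s. s + ?u"
  note A = incidence_mat_carrier[of n es, where ?'a = bit]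
  have edge: "e \<subseteq> {..<n}" "card e = m" if "e \<in> set es" for e
    using unif that unfolding uniform_hypergraph_def by auto
  have "(\<Sum>v\<in>e. ?u $ v) = 0" if "e \<in> set es" for e
  proof -
    have "(\<Sum>v\<in>e. ?u $ v) = (\<Sum>v\<in>e. 1)"
      using edge(1)[OF that] by (intro sum.cong) auto
    also have "\<dots> = of_nat m"
      using edge(2)[OF that] by simp
    also have "\<dots> = 0"
      using m by (auto elim!: evenE)
    finally show ?thesis .
  qed
  then have u: "?u \<in> mat_kernel ?A"
    using edge(1) by (subst mat_kernel_incidence_mat_iff) auto
  have ker: "s \<in> carrier_vec n" if "s \<in> mat_kernel ?A" for s
    using that mat_kernel_carrier[OF A] by blast
  have flip_flip: "?flip (?flip s) = s" if "s \<in> carrier_vec n" for s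
    using that by (intro eq_vecI) (auto simp: add.assoc)
  have "bij_betw ?flip (sign_space n es) (mat_kernel ?A - sign_space n es)"
  proof (rule bij_betw_byWitness[where f' = ?flip])
    show "\<forall>s\<in>sign_space n es. ?flip (?flip s) = s"
      using flip_flip sign_space_carrier by blast
    show "\<forall>s\<in>mat_kernel ?A - sign_space n es. ?flip (?flip s) = s"
      using flip_flip ker by blast
    show "?flip ` sign_space n es \<subseteq> mat_kernel ?A - sign_space n es"
      using mat_kernel_add[OF A _ u] ker n unfolding sign_space_def by auto
    show "?flip ` (mat_kernel ?A - sign_space n es) \<subseteq> sign_space n es"
      using mat_kernel_add[OF A _ u] ker n unfolding sign_space_def by auto
  qed
  then have "card (mat_kernel ?A - sign_space n es) = card (sign_space n es)"
    using bij_betw_same_card by fastforce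
  moreover have sub: "sign_space n es \<subseteq> mat_kernel ?A"
    unfolding sign_space_def by blast
  moreover have "finite (mat_kernel ?A)"
    by (rule finite_mat_kernel_bit[OF A])
  ultimately show ?thesis
    using card_Diff_subset[OF finite_subset[OF sub] sub] card_mono[of "mat_kernel ?A" "sign_space n es"]
    by simp
qed

theorem theorem4p4:
  fixes m n r :: nat and E :: "nat set set" and es :: "nat set list"
  assumes "uniform_hypergraph m n E"
    and "connected_hypergraph n E"
    and "even m"
    and "n \<ge> 2"
    and "distinct es" and "set es = E"
    and "r = vec_space.rank (length es) (incidence_mat n es :: bit mat)"
  shows "1 \<le> r \<and> r \<le> n - 1 \<and>
    vectorspace (class_ring :: bit ring) (HPV0_space m n E) \<and>
    vectorspace.fin_dim (class_ring :: bit ring) (HPV0_space m n E) \<and>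
    vectorspace.dim (class_ring :: bit ring) (HPV0_space m n E) = n - 1 - r \<and>
    card (HPV0 m n E) = 2 ^ (n - 1 - r)"
proof -
  let ?A = "incidence_mat n es :: bit mat"
  note A = incidence_mat_carrier[of n es, where ?'a = bit]
  have unif: "uniform_hypergraph m n (set es)" and conn: "connected_hypergraph n (set es)"
    using assms by simp_all
  have n: "0 < n" using assms(4) by simp
  have edge: "finite e" "e \<subseteq> {..<n}" "card e = m" if "e \<in> set es" for e
    using unif that finite_subset unfolding uniform_hypergraph_def by auto
  obtain e where e: "e \<in> set es" "0 \<in> e"
    using edge_exists[OF conn assms(4)] .
  then have m: "0 < m"
    using edge[OF e(1)] card_gt_0_iff by blast
  have HPV0: "HPV0 m n E = (\<lambda>s. proj_point (sign_vec s)) ` sign_space n es"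
    using HPV0_eq_sign_space[OF unif conn assms(3) m n] assms(6) by simp
  have ker_card: "card (mat_kernel ?A) * 2 ^ r = 2 ^ n"
    using card_mat_kernel_bit[OF A] assms(7) by simp
  have card_HPV0: "card (mat_kernel ?A) = 2 * card (HPV0 m n E)"
    using card_mat_kernel_incidence_mat[OF unif assms(3) n] card_image[OF inj_on_proj_point_sign_vec[OF n]]
    by (simp add: HPV0)
  \<comment> \<open>With rank 0 the kernel would have \<open>2 ^ n\<close> elements and so contain
    every vector, but the unit vector at vertex 0 has sum 1 over the edge \<open>e\<close>.\<close>
  have "r \<noteq> 0"
  proof
    assume "r = 0"
    then have "mat_kernel ?A = carrier_vec n"
      using ker_card card_carrier_vec_bit finite_carrier_vec_bit mat_kernel_carrier[OF A]
      by (intro card_subset_eq) auto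
    then have "(\<Sum>v\<in>e. unit_vec n 0 $ v :: bit) = 0"
      using e edge(2) mat_kernel_incidence_mat_iff[of es n "unit_vec n 0 :: bit vec"] by auto
    moreover have "(\<Sum>v\<in>e. unit_vec n 0 $ v :: bit) = (\<Sum>v\<in>e. if v = 0 then 1 else 0)"
      using edge(2)[OF e(1)] n by (intro sum.cong) auto
    ultimately show False
      using edge(1)[OF e(1)] e(2) by simp
  qed
  interpret V: vectorspace "class_ring :: bit ring" "HPV0_space m n E"
    using vectorspace_HPV0_space[OF unif conn assms(3) m n] assms(6) by simp
  have carrier: "carrier (HPV0_space m n E) = HPV0 m n E"
    by (simp add: HPV0_space_def)
  have "finite (sign_space n es)"
    using finite_mat_kernel_bit[OF A] unfolding sign_space_def by simp
  then have fin_dim: "V.fin_dim"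
    using V.fin_dim_if_finite_carrier carrier HPV0 by simp
  then have card_dim: "card (HPV0 m n E) = 2 ^ V.dim"
    using V.card_carrier_eq_power_dim carrier card_UNIV_bit finite_UNIV_bit by simp
  \<comment> \<open>The kernel has \<open>2 * 2 ^ V.dim\<close> elements, and its cardinality times
    \<open>2 ^ r\<close> is \<open>2 ^ n\<close>. Comparing exponents gives the dimension and the
    upper bound on \<open>r\<close> at once.\<close>
  then have "(2::nat) ^ (1 + V.dim + r) = 2 ^ n"
    using ker_card card_HPV0 by (simp add: power_add)
  then have "1 + V.dim + r = n"
    by (rule power_inject_exp[THEN iffD1, rotated]) simp
  then have "V.dim = n - 1 - r" "r \<le> n - 1"
    by simp_all
  then show ?thesis
    using \<open>r \<noteq> 0\<close> V.vectorspace_axioms fin_dim card_dim by simp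
qed

end
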